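(* If $G$ is a bipartite graph with $\Delta(G)\geq 4$, then $\theta_{\mathrm{int}}(G)\leq \left\lceil \frac{\Delta(G)}{3}\right\rceil$. Moreover, $G$ can be decomposed into $\left\lceil \frac{\Delta(G)}{3}\right\rceil$ edge-disjoint interval colorable subgraphs in such a way that at each vertex the numbers of incident edges, in any pair of subgraphs, differ by at most one.
   Context: Graphs are finite, undirected, may have multiple edges, and have no loops. $\Delta(G)$ is the maximum degree of $G$. For a positive integer $t$, an interval $t$-coloring of a graph is a proper edge coloring with colors $1,2,\dots,t$ such that for every vertex the colors of the edges incident to it form an interval of integers. A graph is interval colorable if it has an interval $t$-coloring for some positive integer $t$. A decomposition of $G$ into $k$ subgraphs is a list of $k$ subgraphs of $G$ such that every edge of $G$ appears in exactly one of them. The interval coloring thickness $\theta_{\mathrm{int}}(G)$ is the minimum positive integer $k$ such that $G$ can be decomposed into $k$ interval colorable subgraphs. *)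

theory Defs
  imports Complex_Main
begin

(* Undirected multigraph: parallel edges are distinct edge names with the same set of ends. *)
record ('v, 'e) multigraph =
  verts :: "'v set"
  edges :: "'e set"
  ends :: "'e \<Rightarrow> 'v set"

(* Loops are excluded by requiring exactly two ends. *)
definition is_multigraph :: "('v, 'e) multigraph \<Rightarrow> bool" where
  "is_multigraph G \<longleftrightarrow>
     finite (verts G) \<and> finite (edges G) \<and>
     (\<forall>e\<in>edges G. ends G e \<subseteq> verts G \<and> card (ends G e) = 2)"

definition bipartite :: "('v, 'e) multigraph \<Rightarrow> bool" where
  "bipartite G \<longleftrightarrow>
     (\<exists>X Y. X \<union> Y = verts G \<and> X \<inter> Y = {} \<and>
        (\<forall>e\<in>edges G. \<exists>x\<in>X. \<exists>y\<in>Y. ends G e = {x, y}))"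

definition incident_edges :: "('v, 'e) multigraph \<Rightarrow> 'v \<Rightarrow> 'e set" where
  "incident_edges G v = {e \<in> edges G. v \<in> ends G e}"

(* For a subgraph H, the degree in H of a vertex not belonging to H is 0. *)
definition degree :: "('v, 'e) multigraph \<Rightarrow> 'v \<Rightarrow> nat" where
  "degree G v = card (incident_edges G v)"

(* The inserted 0 only matters for the graph without vertices. *)
definition max_degree :: "('v, 'e) multigraph \<Rightarrow> nat" where
  "max_degree G = Max (insert 0 (degree G ` verts G))"

definition proper_edge_coloring :: "('v, 'e) multigraph \<Rightarrow> ('e \<Rightarrow> nat) \<Rightarrow> bool" where
  "proper_edge_coloring G c \<longleftrightarrow>
     (\<forall>e\<in>edges G. \<forall>f\<in>edges G. e \<noteq> f \<and> ends G e \<inter> ends G f \<noteq> {} \<longrightarrow> c e \<noteq> c f)"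

(* The interval at a vertex may be empty (a > b), which covers isolated vertices.
   Not every color in {1..t} has to be used. *)
definition interval_coloring :: "('v, 'e) multigraph \<Rightarrow> nat \<Rightarrow> ('e \<Rightarrow> nat) \<Rightarrow> bool" where
  "interval_coloring G t c \<longleftrightarrow>
     proper_edge_coloring G c \<and> c ` edges G \<subseteq> {1..t} \<and>
     (\<forall>v\<in>verts G. \<exists>a b. c ` incident_edges G v = {a..b})"

definition interval_colorable :: "('v, 'e) multigraph \<Rightarrow> bool" where
  "interval_colorable G \<longleftrightarrow> (\<exists>t>0. \<exists>c. interval_coloring G t c)"

definition subgraph :: "('v, 'e) multigraph \<Rightarrow> ('v, 'e) multigraph \<Rightarrow> bool" where
  "subgraph H G \<longleftrightarrow>
     is_multigraph H \<and> verts H \<subseteq> verts G \<and> edges H \<subseteq> edges G \<and>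
     (\<forall>e\<in>edges H. ends H e = ends G e)"

definition decomposition ::
    "('v, 'e) multigraph \<Rightarrow> ('v, 'e) multigraph list \<Rightarrow> bool" where
  "decomposition G Hs \<longleftrightarrow>
     (\<forall>H\<in>set Hs. subgraph H G) \<and>
     (\<forall>e\<in>edges G. \<exists>!i. i < length Hs \<and> e \<in> edges (Hs ! i))"

(* The set minimized over is never empty for a finite loopless multigraph: take the
   subgraphs consisting of single edges (or G itself if G has no edges). *)
definition interval_thickness :: "('v, 'e) multigraph \<Rightarrow> nat" where
  "interval_thickness G =
     (LEAST k. k > 0 \<and>
        (\<exists>Hs. length Hs = k \<and> decomposition G Hs \<and> (\<forall>H\<in>set Hs. interval_colorable H)))"

end

theory Submission imports Defs begin

text \<open>
  Write \<open>k = \<lceil>\<Delta>(G)/3\<rceil>\<close>. Two facts about a bipartite multigraph combine to give the result.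

  First, for every \<open>k > 0\<close> its edges can be colored with \<open>k\<close> colors, not necessarily properly, so
  that at each vertex any two colors occur equally often up to one
  (\<open>equitable_edge_coloring\<close>, a theorem of de Werra). For two colors this holds because the
  edges at each vertex can be paired off, leaving at most one edge over. Joining paired edges gives
  each edge at most one partner at either of its ends, so the edges fall into paths and cycles, along
  which partners at the one side and partners at the other side alternate; the cycles are therefore
  even and one can color alternately (\<open>two_pairings_separated\<close>, \<open>balanced_halving\<close>). For more
  colors, take a coloring that minimizes the sum over all vertices and colors of the squares of the
  color multiplicities: if two colors were unbalanced at some vertex, halving their union would
  decrease this sum.

  Second, a bipartite multigraph with all degrees at most 3 is interval colorable with the colors
  1 to 4 (\<open>interval_colorable_if_degree_le_3\<close>, after Hansen). Choose a matching \<open>M\<close> that covers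
  all vertices of degree 3 and has such a vertex on each of its edges. What remains has degrees at
  most 2 and is properly colored with 2 and 3. An edge of \<open>M\<close> receives 1 or 4. Both choices are good
  at an end of degree 3, so at most one end of the edge, one of degree 2, dictates the choice.

  In an equitable coloring with \<open>k\<close> colors every color class has degrees at most 3, because a color
  occurring at least 4 times at a vertex would force all others to occur at least 3 times, and the
  degree would exceed \<open>3k \<ge> \<Delta>(G)\<close>. So the color classes are the required subgraphs.
\<close>

section \<open>Two pairings of a finite set\<close>

text \<open>A partition into classes of at most two elements, given by a labelling of the elements. The
  first-order form avoids counting when elements are removed or classes merged.\<close>

definition pairs_up :: "('e \<Rightarrow> 'a) \<Rightarrow> 'e set \<Rightarrow> bool" where
  "pairs_up p E \<longleftrightarrow>
     (\<forall>x\<in>E. \<forall>y\<in>E. \<forall>z\<in>E. p x = p y \<and> p y = p z \<longrightarrow> x = y \<or> y = z \<or> x = z)"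

lemma pairs_upD:
  "pairs_up p E \<Longrightarrow> x \<in> E \<Longrightarrow> y \<in> E \<Longrightarrow> z \<in> E \<Longrightarrow> p x = p y \<Longrightarrow> p y = p z \<Longrightarrow>
    x = y \<or> y = z \<or> x = z"
  unfolding pairs_up_def by blast

text \<open>The graph on \<open>E\<close> formed by two matchings has only even cycles, hence is 2-colorable. Instead of
  following paths, the induction contracts a segment: for a pair \<open>e, f\<close> of the labelling \<open>p\<close>, delete both
  elements and make their partners under \<open>q\<close> a new pair. A coloring that separates these partners
  extends to \<open>e\<close> and \<open>f\<close> with opposite colors.\<close>

lemma two_pairings_separated:
  fixes p :: "'e \<Rightarrow> 'a" and q :: "'e \<Rightarrow> 'b"
  assumes "finite E" and "pairs_up p E" and "pairs_up q E"
  shows "\<exists>c :: 'e \<Rightarrow> bool. \<forall>x\<in>E. \<forall>y\<in>E. x \<noteq> y \<and> (p x = p y \<or> q x = q y) \<longrightarrow> c x \<noteq> c y"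
  using assms
proof (induction "card E" arbitrary: E q rule: less_induct)
  case less
  note fin = less.prems(1) and P = less.prems(2) and Q = less.prems(3)
  show ?case
  proof (cases "inj_on p E")
    case True
    \<comment> \<open>Only \<open>q\<close> imposes constraints, so marking one representative of each class suffices.\<close>
    define c where "c x \<longleftrightarrow> x = (SOME g. g \<in> E \<and> q g = q x)" for x
    have "c x \<noteq> c y" if "x \<in> E" "y \<in> E" "x \<noteq> y" "q x = q y" for x y
    proof -
      define g where "g = (SOME g. g \<in> E \<and> q g = q x)"
      have "g \<in> E \<and> q g = q x"
        unfolding g_def using that by (intro someI[of "\<lambda>g. g \<in> E \<and> q g = q x"]) auto
      then have "x = y \<or> y = g \<or> x = g"
        using that by (intro pairs_upD[OF Q]) auto
      moreover have "c x \<longleftrightarrow> x = g" "c y \<longleftrightarrow> y = g"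
        unfolding c_def g_def using that by simp_all
      ultimately show ?thesis
        using \<open>x \<noteq> y\<close> by auto
    qed
    then show ?thesis
      using inj_onD[OF True] by (intro exI[of _ c]) blast
  next
    case False
    then obtain e f where ef: "e \<in> E" "f \<in> E" "e \<noteq> f" "p e = p f"
      unfolding inj_on_def by blast
    define E' where "E' = E - {e, f}"
    \<comment> \<open>This merges the classes of \<open>e\<close> and \<open>f\<close> under \<open>q\<close>, leaving their former partners as a pair.\<close>
    define q' where "q' g = (if q g = q f then q e else q g)" for g
    have card: "card E' < card E"
      unfolding E'_def using ef fin by (intro psubset_card_mono) auto
    have prems: "finite E'" "pairs_up p E'"
      using fin P unfolding E'_def pairs_up_def by auto
    \<comment> \<open>A class containing \<open>e\<close> or \<open>f\<close> has room for only one surviving element.\<close>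
    have same: "u = w" if "u \<in> E'" "w \<in> E'" "q u = q w" "q u \<in> {q e, q f}" for u w
      using pairs_upD[OF Q, of u w e] pairs_upD[OF Q, of u w f] that ef
      unfolding E'_def by auto
    have "pairs_up q' E'"
      unfolding pairs_up_def
    proof (intro ballI impI)
      fix x y z
      assume xyz: "x \<in> E'" "y \<in> E'" "z \<in> E'" and eq: "q' x = q' y \<and> q' y = q' z"
      show "x = y \<or> y = z \<or> x = z"
      proof (cases "q' x = q e")
        case True
        then have "q x \<in> {q e, q f}" "q y \<in> {q e, q f}" "q z \<in> {q e, q f}"
          using eq unfolding q'_def by (auto split: if_splits)
        then show ?thesis
          using same[of x y] same[of y z] same[of x z] xyz by auto
      next
        case False
        then have "q x = q y" "q y = q z"
          using eq unfolding q'_def by (auto split: if_splits)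
        then show ?thesis
          using pairs_upD[OF Q, of x y z] xyz unfolding E'_def by auto
      qed
    qed
    with card prems obtain c where c:
      "\<And>x y. x \<in> E' \<Longrightarrow> y \<in> E' \<Longrightarrow> x \<noteq> y \<Longrightarrow> p x = p y \<or> q' x = q' y \<Longrightarrow> c x \<noteq> (c y :: bool)"
      using less.hyps[of E' q'] by blast
    have diff: "c u \<noteq> c w" if "u \<in> E'" "w \<in> E'" "q u = q e" "q w = q f" for u w
    proof -
      have "u \<noteq> w"
        using that pairs_upD[OF Q, of e f u] ef unfolding E'_def by auto
      then show ?thesis
        using c[of u w] that unfolding q'_def by auto
    qed
    \<comment> \<open>The value \<open>a\<close> is the color for \<open>e\<close>, and its opposite the color for \<open>f\<close>.\<close>
    have "\<exists>a. (\<forall>g\<in>E'. q g = q e \<longrightarrow> c g \<noteq> a) \<and> (\<forall>g\<in>E'. q g = q f \<longrightarrow> c g = a)"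
    proof (cases "\<exists>g\<in>E'. q g = q f")
      case True
      then show ?thesis using same diff by (metis insertCI)
    next
      case False
      then show ?thesis using same by (metis insertCI)
    qed
    then obtain a where a:
      "\<And>g. g \<in> E' \<Longrightarrow> q g = q e \<Longrightarrow> c g \<noteq> a" "\<And>g. g \<in> E' \<Longrightarrow> q g = q f \<Longrightarrow> c g = a"
      by blast
    have noP: "p g \<noteq> p e" if "g \<in> E'" for g
      using that pairs_upD[OF P, of g e f] ef unfolding E'_def by auto
    have cE': "c x \<noteq> c y"
      if "x \<in> E'" "y \<in> E'" "x \<noteq> y" "p x = p y \<or> q x = q y" for x y
    proof -
      have "p x = p y \<or> q' x = q' y"
        using that(4) unfolding q'_def by metis
      then show ?thesis
        by (rule c[OF that(1-3)])
    qed
    define c' where "c' x = (if x = e then a else if x = f then \<not> a else c x)" for x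
    have new: "c' e \<noteq> c' f" "c' f \<noteq> c' e"
      unfolding c'_def using ef by auto
    have mixed: "c' x \<noteq> c' y" "c' y \<noteq> c' x"
      if "x \<in> {e, f}" "y \<in> E'" "p x = p y \<or> q x = q y" for x y
      using that a[of y] noP[of y] ef unfolding c'_def E'_def by auto
    have old: "c' x \<noteq> c' y"
      if "x \<in> E'" "y \<in> E'" "x \<noteq> y" "p x = p y \<or> q x = q y" for x y
      using cE'[OF that] that unfolding c'_def E'_def by simp
    have "c' x \<noteq> c' y" if xy: "x \<in> E" "y \<in> E" "x \<noteq> y" "p x = p y \<or> q x = q y" for x y
    proof -
      have yx: "p y = p x \<or> q y = q x" using xy(4) by metis
      consider "x \<in> {e, f}" "y \<in> {e, f}" | "x \<in> {e, f}" "y \<in> E'" | "x \<in> E'" "y \<in> {e, f}"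
        | "x \<in> E'" "y \<in> E'"
        using xy(1,2) unfolding E'_def by blast
      then show ?thesis
      proof cases
        case 1
        then show ?thesis using new xy(3) by blast
      next
        case 2
        then show ?thesis using mixed(1) xy(4) by blast
      next
        case 3
        then show ?thesis using mixed(2) yx by blast
      next
        case 4
        then show ?thesis using old xy(3,4) by blast
      qed
    qed
    then show ?thesis by blast
  qed
qed

section \<open>Equitable edge colorings of bipartite multigraphs\<close>

text \<open>Pairing off all elements but at most one turns the balance condition at a vertex into
  separation of pairs: each pair contributes one element to either side.\<close>

lemma finite_pairing:
  fixes F :: "'e set"
  assumes "finite F"
  shows "\<exists>r :: 'e \<Rightarrow> nat. pairs_up r F \<and>
    (\<forall>c. (\<forall>x\<in>F. \<forall>y\<in>F. x \<noteq> y \<and> r x = r y \<longrightarrow> c x \<noteq> c y) \<longrightarrow>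
       card {x\<in>F. c x} \<le> card {x\<in>F. \<not> c x} + 1 \<and> card {x\<in>F. \<not> c x} \<le> card {x\<in>F. c x} + 1)"
  using assms
proof (induction "card F" arbitrary: F rule: less_induct)
  case less
  show ?case
  proof (cases "card F \<le> 1")
    case True
    have "card {x\<in>F. P x} \<le> 1" for P
      using True card_mono[OF less.prems, of "{x\<in>F. P x}"] by auto
    then have "card {x\<in>F. P x} \<le> n + 1" for P and n :: nat
      by (metis le_add2 le_trans)
    moreover have "pairs_up (\<lambda>_. 0) F"
      using True less.prems unfolding pairs_up_def by (auto simp: card_le_Suc0_iff_eq)
    ultimately show ?thesis by (intro exI[of _ "\<lambda>_. 0"]) simp
  next
    case False
    then obtain e f where ef: "e \<in> F" "f \<in> F" "e \<noteq> f"
      using less.prems by (auto simp: card_le_Suc0_iff_eq)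
    define F' where "F' = F - {e, f}"
    have F: "F = insert e (insert f F')" "e \<notin> F'" "f \<notin> F'" and fin: "finite F'"
      using ef less.prems unfolding F'_def by auto
    have "card F' < card F"
      unfolding F'_def using ef less.prems by (intro psubset_card_mono) auto
    then obtain r :: "'e \<Rightarrow> nat" where r: "pairs_up r F'"
      "\<And>c. (\<forall>x\<in>F'. \<forall>y\<in>F'. x \<noteq> y \<and> r x = r y \<longrightarrow> c x \<noteq> c y) \<Longrightarrow>
       card {x\<in>F'. c x} \<le> card {x\<in>F'. \<not> c x} + 1 \<and>
       card {x\<in>F'. \<not> c x} \<le> card {x\<in>F'. c x} + 1"
      using less.hyps[OF _ fin] by blast
    define r' where "r' x = (if x \<in> {e, f} then 0 else Suc (r x))" for x
    have "pairs_up r' F"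
      unfolding pairs_up_def
    proof (intro ballI impI)
      fix x y z
      assume xyz: "x \<in> F" "y \<in> F" "z \<in> F" and eq: "r' x = r' y \<and> r' y = r' z"
      show "x = y \<or> y = z \<or> x = z"
        using pairs_upD[OF r(1), of x y z] xyz eq unfolding r'_def F'_def
        by (auto split: if_splits)
    qed
    moreover have "card {x\<in>F. c x} \<le> card {x\<in>F. \<not> c x} + 1 \<and>
        card {x\<in>F. \<not> c x} \<le> card {x\<in>F. c x} + 1"
      if sep: "\<forall>x\<in>F. \<forall>y\<in>F. x \<noteq> y \<and> r' x = r' y \<longrightarrow> c x \<noteq> c y" for c
    proof -
      have "\<forall>x\<in>F'. \<forall>y\<in>F'. x \<noteq> y \<and> r x = r y \<longrightarrow> c x \<noteq> c y"
        using sep unfolding r'_def F'_def by auto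
      note IH = r(2)[OF this]
      have ne: "c e \<noteq> c f"
        using sep[rule_format, of e f] ef unfolding r'_def by simp
      have *: "card {x\<in>F. P x} = Suc (card {x\<in>F'. P x})" if "P e \<noteq> P f" for P
      proof -
        have "{x\<in>F. P x} = insert (if P e then e else f) {x\<in>F'. P x}"
          using that unfolding F(1) by (cases "P e") auto
        then show ?thesis using F(2,3) fin by simp
      qed
      show ?thesis
        using IH *[of c, OF ne] *[of "\<lambda>x. \<not> c x"] ne by simp
    qed
    ultimately show ?thesis by blast
  qed
qed

abbreviation restrict_edges :: "('v, 'e) multigraph \<Rightarrow> 'e set \<Rightarrow> ('v, 'e) multigraph" where
  "restrict_edges G F \<equiv> G\<lparr>edges := F\<rparr>"

abbreviation color_class ::
    "('v, 'e) multigraph \<Rightarrow> ('e \<Rightarrow> 'c) \<Rightarrow> 'c \<Rightarrow> ('v, 'e) multigraph" where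
  "color_class G c i \<equiv> restrict_edges G {e \<in> edges G. c e = i}"

lemma restrict_edges_multigraph:
  "is_multigraph G \<Longrightarrow> F \<subseteq> edges G \<Longrightarrow> is_multigraph (restrict_edges G F)"
  unfolding is_multigraph_def by (auto intro: finite_subset)

lemma restrict_edges_bipartite:
  "bipartite G \<Longrightarrow> F \<subseteq> edges G \<Longrightarrow> bipartite (restrict_edges G F)"
  unfolding bipartite_def by (auto simp del: ex_simps) (meson subsetD)

lemma degree_restrict_edges:
  "degree (restrict_edges G F) v = card {e \<in> F. v \<in> ends G e}"
  unfolding degree_def incident_edges_def by simp

lemma degree_color_class:
  "degree (color_class G c i) v = card {e \<in> incident_edges G v. c e = i}"
  unfolding degree_restrict_edges incident_edges_def by (rule arg_cong[of _ _ card]) auto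

lemma finite_incident: "is_multigraph G \<Longrightarrow> finite (incident_edges G v)"
  unfolding is_multigraph_def incident_edges_def by auto

text \<open>Bipartiteness enters here: each edge has one end in either part, so the pairings of the edges
  at the vertices of one part form a single pairing of all edges, and likewise for the other part.\<close>

lemma balanced_halving:
  fixes G :: "('v, 'e) multigraph"
  assumes G: "is_multigraph G" and "bipartite G"
  shows "\<exists>h :: 'e \<Rightarrow> bool. \<forall>v\<in>verts G. \<forall>a b.
    degree (color_class G h a) v \<le> degree (color_class G h b) v + 1"
proof -
  from assms(2) obtain X Y where XY: "X \<union> Y = verts G" "X \<inter> Y = {}"
    and ends: "\<forall>e\<in>edges G. \<exists>x\<in>X. \<exists>y\<in>Y. ends G e = {x, y}"
    unfolding bipartite_def by (elim exE conjE)
  from ends obtain p q where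
    pq: "\<And>e. e \<in> edges G \<Longrightarrow> p e \<in> X \<and> q e \<in> Y \<and> ends G e = {p e, q e}"
    unfolding Bex_def by metis
  have incX: "incident_edges G v = {e \<in> edges G. p e = v}" if "v \<in> X" for v
    using that pq XY(2) unfolding incident_edges_def by fastforce
  have incY: "incident_edges G v = {e \<in> edges G. q e = v}" if "v \<in> Y" for v
    using that pq XY(2) unfolding incident_edges_def by fastforce
  have "\<exists>r :: 'v \<Rightarrow> 'e \<Rightarrow> nat. \<forall>v. pairs_up (r v) (incident_edges G v) \<and>
    (\<forall>c. (\<forall>x\<in>incident_edges G v. \<forall>y\<in>incident_edges G v. x \<noteq> y \<and> r v x = r v y \<longrightarrow> c x \<noteq> c y) \<longrightarrow>
       card {x\<in>incident_edges G v. c x} \<le> card {x\<in>incident_edges G v. \<not> c x} + 1 \<and>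
       card {x\<in>incident_edges G v. \<not> c x} \<le> card {x\<in>incident_edges G v. c x} + 1)"
    by (intro choice allI finite_pairing finite_incident[OF G])
  then obtain r :: "'v \<Rightarrow> 'e \<Rightarrow> nat" where r: "\<And>v. pairs_up (r v) (incident_edges G v)"
    "\<And>v c. (\<forall>x\<in>incident_edges G v. \<forall>y\<in>incident_edges G v. x \<noteq> y \<and> r v x = r v y \<longrightarrow> c x \<noteq> c y) \<Longrightarrow>
       card {x\<in>incident_edges G v. c x} \<le> card {x\<in>incident_edges G v. \<not> c x} + 1 \<and>
       card {x\<in>incident_edges G v. \<not> c x} \<le> card {x\<in>incident_edges G v. c x} + 1"
    by (elim exE) blast
  \<comment> \<open>Labelling an edge by an end together with its label there collects the local pairings.\<close>
  have up: "pairs_up (\<lambda>e. (s e, r (s e) e)) (edges G)"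
    if s: "\<And>e. e \<in> edges G \<Longrightarrow> incident_edges G (s e) = {f \<in> edges G. s f = s e}" for s
    unfolding pairs_up_def
  proof (intro ballI impI)
    fix x y z
    assume xyz: "x \<in> edges G" "y \<in> edges G" "z \<in> edges G"
      and "(s x, r (s x) x) = (s y, r (s y) y) \<and> (s y, r (s y) y) = (s z, r (s z) z)"
    then have eq: "s y = s x" "s z = s x" "r (s x) x = r (s x) y" "r (s x) y = r (s x) z"
      by auto
    then have "x \<in> incident_edges G (s x)" "y \<in> incident_edges G (s x)" "z \<in> incident_edges G (s x)"
      unfolding s[OF xyz(1)] using xyz by simp_all
    then show "x = y \<or> y = z \<or> x = z"
      using eq by (intro pairs_upD[OF r(1)])
  qed
  have "pairs_up (\<lambda>e. (p e, r (p e) e)) (edges G)" "pairs_up (\<lambda>e. (q e, r (q e) e)) (edges G)"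
    using pq incX incY by (intro up; simp)+
  moreover have "finite (edges G)"
    using G unfolding is_multigraph_def by simp
  ultimately obtain h :: "'e \<Rightarrow> bool" where h: "\<And>x y. x \<in> edges G \<Longrightarrow> y \<in> edges G \<Longrightarrow> x \<noteq> y \<Longrightarrow>
      p x = p y \<and> r (p x) x = r (p y) y \<or> q x = q y \<and> r (q x) x = r (q y) y \<Longrightarrow> h x \<noteq> h y"
    using two_pairings_separated[of "edges G" "\<lambda>e. (p e, r (p e) e)" "\<lambda>e. (q e, r (q e) e)"]
    by auto
  have "degree (color_class G h a) v \<le> degree (color_class G h b) v + 1" if "v \<in> verts G" for v a b
  proof -
    have "v \<in> X \<or> v \<in> Y" using that XY by auto
    then have "\<forall>x\<in>incident_edges G v. \<forall>y\<in>incident_edges G v. x \<noteq> y \<and> r v x = r v y \<longrightarrow> h x \<noteq> h y"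
    proof (elim disjE)
      assume "v \<in> X"
      show ?thesis
        unfolding incX[OF \<open>v \<in> X\<close>] by (intro ballI impI h) simp_all
    next
      assume "v \<in> Y"
      show ?thesis
        unfolding incY[OF \<open>v \<in> Y\<close>] by (intro ballI impI h) simp_all
    qed
    from r(2)[OF this] show ?thesis
      unfolding degree_color_class by (cases a; cases b) auto
  qed
  then show ?thesis by blast
qed

text \<open>Among pairs with a given sum, the sum of squares grows with the distance of the entries, since
  \<open>2(u\<^sup>2 + w\<^sup>2) = (u + w)\<^sup>2 + (u - w)\<^sup>2\<close>, and a distance of at most 1 is the least possible.\<close>

lemma rebalanced_squares:
  fixes a b x y :: nat
  assumes "a + b = x + y" "x \<le> y + 1" "y \<le> x + 1"
  shows "x\<^sup>2 + y\<^sup>2 \<le> a\<^sup>2 + b\<^sup>2" and "a \<ge> b + 2 \<Longrightarrow> x\<^sup>2 + y\<^sup>2 < a\<^sup>2 + b\<^sup>2"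
proof -
  have sq: "2 * (int u ^ 2 + int w ^ 2) = (int u + int w)^2 + (int u - int w)^2" for u w
    by (simp add: power2_eq_square algebra_simps)
  have s: "int a + int b = int x + int y" using assms by linarith
  have xy: "\<bar>int x - int y\<bar> \<le> 1" using assms by linarith
  have "\<bar>int x - int y\<bar> \<le> \<bar>int a - int b\<bar>"
  proof (cases "a = b")
    case True
    then have "x = y" using assms by presburger
    then show ?thesis by simp
  qed (use xy in linarith)
  then have "(int x - int y)^2 \<le> (int a - int b)^2"
    by (rule iffD1[OF abs_le_square_iff])
  then have "int x^2 + int y^2 \<le> int a^2 + int b^2"
    using sq[of x y] sq[of a b] s by simp
  then show "x\<^sup>2 + y\<^sup>2 \<le> a\<^sup>2 + b\<^sup>2"
    by (metis of_nat_add of_nat_le_iff of_nat_power)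
  assume "a \<ge> b + 2"
  then have "\<bar>int x - int y\<bar> < \<bar>int a - int b\<bar>" using xy by linarith
  then have "(int x - int y)^2 < (int a - int b)^2"
    by (metis abs_le_square_iff not_le)
  then have "int x^2 + int y^2 < int a^2 + int b^2"
    using sq[of x y] sq[of a b] s by simp
  then show "x\<^sup>2 + y\<^sup>2 < a\<^sup>2 + b\<^sup>2"
    by (metis of_nat_add of_nat_less_iff of_nat_power)
qed

text \<open>A coloring minimizing the sum of squared multiplicities is equitable: otherwise recolor the
  edges of two unbalanced colors by a balanced halving. By \<open>rebalanced_squares\<close> this increases the sum
  at no vertex and decreases it where the two colors were unbalanced.\<close>

theorem equitable_edge_coloring:
  fixes G :: "('v, 'e) multigraph" and k :: nat
  assumes G: "is_multigraph G" and bip: "bipartite G" and "k > 0"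
  shows "\<exists>c. (\<forall>e\<in>edges G. c e < k) \<and> (\<forall>v\<in>verts G. \<forall>i<k. \<forall>j<k.
    degree (color_class G c i) v \<le> degree (color_class G c j) v + 1)"
proof -
  define d where "d c i v = degree (color_class G c i) v" for c :: "'e \<Rightarrow> nat" and i v
  define \<Phi> where "\<Phi> c = (\<Sum>v\<in>verts G. \<Sum>i<k. (d c i v)\<^sup>2)" for c
  have "\<forall>e\<in>edges G. (\<lambda>_. 0) e < k" using \<open>k > 0\<close> by simp
  then obtain c where ck: "\<forall>e\<in>edges G. c e < k"
    and least: "\<And>c'. \<forall>e\<in>edges G. c' e < k \<Longrightarrow> \<Phi> c \<le> \<Phi> c'"
    using ex_has_least_nat[of "\<lambda>c. \<forall>e\<in>edges G. c e < k" "\<lambda>_. 0" \<Phi>] by blast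
  have "d c i w \<le> d c j w + 1" if w: "w \<in> verts G" and ij: "i < k" "j < k" for w i j
  proof (rule ccontr)
    assume "\<not> ?thesis"
    then have big: "d c i w \<ge> d c j w + 2" by simp
    then have ne: "i \<noteq> j" by auto
    define F where "F = {e \<in> edges G. c e \<in> {i, j}}"
    have F: "F \<subseteq> edges G" unfolding F_def by auto
    let ?H = "restrict_edges G F"
    obtain h :: "'e \<Rightarrow> bool" where h: "\<And>v a b. v \<in> verts G \<Longrightarrow>
        degree (color_class ?H h a) v \<le> degree (color_class ?H h b) v + 1"
      using balanced_halving[OF restrict_edges_multigraph[OF G F] restrict_edges_bipartite[OF bip F]]
      by auto
    define c' where "c' e = (if e \<in> F then if h e then i else j else c e)" for e
    have ck': "\<forall>e\<in>edges G. c' e < k" using ck ij unfolding c'_def by auto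
    have d'i: "d c' i v = degree (color_class ?H h True) v" for v
      unfolding d_def degree_restrict_edges
      by (rule arg_cong[of _ _ card]) (use F ne in \<open>auto simp: c'_def F_def\<close>)
    have d'j: "d c' j v = degree (color_class ?H h False) v" for v
      unfolding d_def degree_restrict_edges
      by (rule arg_cong[of _ _ card]) (use F ne in \<open>auto simp: c'_def F_def\<close>)
    have other: "d c' l v = d c l v" if "l \<noteq> i" "l \<noteq> j" for l v
      unfolding d_def degree_restrict_edges
      by (rule arg_cong[of _ _ card]) (use that in \<open>auto simp: c'_def F_def\<close>)
    have fin: "finite (edges G)" using G unfolding is_multigraph_def by simp
    have two: "d b i v + d b j v = card {e \<in> F. v \<in> ends G e}"
      if b: "\<And>e. e \<in> edges G \<Longrightarrow> b e \<in> {i, j} \<longleftrightarrow> e \<in> F" for b v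
    proof -
      have "{e \<in> F. v \<in> ends G e} =
          {e \<in> {e \<in> edges G. b e = i}. v \<in> ends G e} \<union> {e \<in> {e \<in> edges G. b e = j}. v \<in> ends G e}"
        using b F by auto
      then show ?thesis
        unfolding d_def degree_restrict_edges using ne fin
        by (simp add: card_Un_disjoint disjoint_iff)
    qed
    have sum: "d c i v + d c j v = d c' i v + d c' j v" for v
      using two[of c v] two[of c' v] unfolding c'_def F_def by auto
    have parts: "(\<Sum>l<k. (d b l v)\<^sup>2) = (\<Sum>l\<in>{..<k} - {i, j}. (d b l v)\<^sup>2) + ((d b i v)\<^sup>2 + (d b j v)\<^sup>2)" for b v
    proof -
      have "{i, j} \<subseteq> {..<k}" using ij by auto
      from sum.subset_diff[OF this, of "\<lambda>l. (d b l v)\<^sup>2"] show ?thesis using ne by simp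
    qed
    have rest: "(\<Sum>l\<in>{..<k} - {i, j}. (d c' l v)\<^sup>2) = (\<Sum>l\<in>{..<k} - {i, j}. (d c l v)\<^sup>2)" for v
      by (rule sum.cong) (auto simp: other)
    have balanced: "d c' i v \<le> d c' j v + 1" "d c' j v \<le> d c' i v + 1" if "v \<in> verts G" for v
      unfolding d'i d'j using h[OF that] by blast+
    have "\<Phi> c' < \<Phi> c"
      unfolding \<Phi>_def
    proof (rule sum_strict_mono_ex1)
      show "finite (verts G)" using G unfolding is_multigraph_def by simp
      show "\<forall>v\<in>verts G. (\<Sum>l<k. (d c' l v)\<^sup>2) \<le> (\<Sum>l<k. (d c l v)\<^sup>2)"
        unfolding parts rest using rebalanced_squares(1)[OF sum balanced] by simp
      show "\<exists>v\<in>verts G. (\<Sum>l<k. (d c' l v)\<^sup>2) < (\<Sum>l<k. (d c l v)\<^sup>2)"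
        unfolding parts rest using rebalanced_squares(2)[OF sum balanced[OF w] big] w by auto
    qed
    with least[OF ck'] show False by simp
  qed
  then show ?thesis using ck unfolding d_def by blast
qed

lemma degree_eq_sum_color_classes:
  fixes c :: "'e \<Rightarrow> nat" and G :: "('v, 'e) multigraph"
  assumes G: "is_multigraph G" and c: "\<forall>e\<in>edges G. c e < k"
  shows "degree G v = (\<Sum>i<k. degree (color_class G c i) v)"
proof -
  have "c ` incident_edges G v \<subseteq> {..<k}"
    using c unfolding incident_edges_def by auto
  then show ?thesis
    unfolding degree_color_class unfolding degree_def
    using sum.group[OF finite_incident[OF G, of v] finite_lessThan, of c k "\<lambda>_. 1::nat"] by simp
qed

text \<open>If one color exceeded \<open>m\<close> at a vertex, every other color would occur at least \<open>m\<close> times there,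
  which is more than \<open>m * k\<close> edges in all. With \<open>m = 1\<close> this says that an equitable coloring with at
  least as many colors as the maximum degree is proper.\<close>

lemma equitable_class_degree_le:
  fixes c :: "'e \<Rightarrow> nat" and G :: "('v, 'e) multigraph"
  assumes G: "is_multigraph G" and c: "\<forall>e\<in>edges G. c e < k"
    and eq: "\<forall>i<k. \<forall>j<k. degree (color_class G c i) v \<le> degree (color_class G c j) v + 1"
    and "degree G v \<le> m * k" and i: "i < k"
  shows "degree (color_class G c i) v \<le> m"
proof (rule ccontr)
  assume "\<not> ?thesis"
  then have big: "degree (color_class G c i) v \<ge> m + 1" by simp
  have "m * k = (\<Sum>j<k. m)" by simp
  also have "\<dots> < (\<Sum>j<k. degree (color_class G c j) v)"
  proof (rule sum_strict_mono_ex1)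
    show "\<forall>j\<in>{..<k}. m \<le> degree (color_class G c j) v"
      using eq i big by fastforce
    show "\<exists>j\<in>{..<k}. m < degree (color_class G c j) v"
      using i big by (intro bexI[of _ i]) auto
  qed simp
  also have "\<dots> = degree G v"
    using degree_eq_sum_color_classes[OF G c] by simp
  finally show False using assms(4) by simp
qed

section \<open>Interval colorings\<close>

text \<open>An equitable 3-coloring is proper here, and each of its classes is a matching that meets every
  vertex of degree 3. Let \<open>M\<close> be the edges of one class that have an end of degree 3. The halving
  \<open>h\<close> of the other edges is again proper, since these have degrees at most 2, and gives them the colors
  2 and 3. At a vertex of degree 3 the edge of \<open>M\<close> may have color 1 or 4; at a vertex of degree 2
  it must be adjacent to the color of the other edge, that is, 1 next to 2 and 4 next to 3. No edge of
  \<open>M\<close> has two ends of degree 2, so these demands never conflict.\<close>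

lemma interval_colorable_if_degree_le_3:
  fixes G :: "('v, 'e) multigraph"
  assumes G: "is_multigraph G" and bip: "bipartite G"
    and le3: "\<And>v. v \<in> verts G \<Longrightarrow> degree G v \<le> 3"
  shows "interval_colorable G"
proof -
  let ?I = "incident_edges G"
  note fin = finite_incident[OF G]
  obtain m :: "'e \<Rightarrow> nat" where m3: "\<forall>e\<in>edges G. m e < 3" and m: "\<forall>v\<in>verts G. \<forall>i<3. \<forall>j<3.
      degree (color_class G m i) v \<le> degree (color_class G m j) v + 1"
    using equitable_edge_coloring[OF G bip, of 3] by auto
  have class1: "card {e \<in> ?I v. m e = i} \<le> 1" if "v \<in> verts G" "i < 3" for v i
    using equitable_class_degree_le[OF G m3, of v 1 i] m le3 that
    by (simp add: degree_color_class)
  have class_sum: "degree G v = (\<Sum>i<3. card {e \<in> ?I v. m e = i})" for v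
    using degree_eq_sum_color_classes[OF G m3] by (simp add: degree_color_class)
  have verts: "v \<in> verts G" if "e \<in> edges G" "v \<in> ends G e" for e v
    using G that unfolding is_multigraph_def by auto
  define M where "M = {e \<in> edges G. m e = 0 \<and> (\<exists>v\<in>ends G e. degree G v = 3)}"
  have M_matching: "e = f" if "v \<in> verts G" "e \<in> ?I v \<inter> M" "f \<in> ?I v \<inter> M" for v e f
    using class1[OF that(1), of 0] that fin[of v]
    by (auto simp: M_def card_le_Suc0_iff_eq)
  have M_covers: "?I v \<inter> M \<noteq> {}" if "v \<in> verts G" "degree G v = 3" for v
  proof -
    have "card {e \<in> ?I v. m e = 0} \<noteq> 0"
      using class_sum[of v] class1[OF that(1), of 0] class1[OF that(1), of 1]
        class1[OF that(1), of 2] that(2)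
      by (simp add: eval_nat_numeral lessThan_Suc)
    then have "{e \<in> ?I v. m e = 0} \<noteq> {}" by (metis card.empty)
    then show ?thesis using that unfolding M_def incident_edges_def by auto
  qed
  define R where "R = edges G - M"
  have R: "R \<subseteq> edges G" unfolding R_def by auto
  obtain h :: "'e \<Rightarrow> bool" where h: "\<And>v a b. v \<in> verts G \<Longrightarrow>
      degree (color_class (restrict_edges G R) h a) v \<le> degree (color_class (restrict_edges G R) h b) v + 1"
    using balanced_halving[OF restrict_edges_multigraph[OF G R] restrict_edges_bipartite[OF bip R]]
    by auto
  have h_class: "degree (color_class (restrict_edges G R) h a) v = card {e \<in> ?I v - M. h e = a}" for a v
    unfolding degree_restrict_edges
    by (rule arg_cong[of _ _ card]) (auto simp: R_def incident_edges_def)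
  have rest2: "card (?I v - M) \<le> 2" if v: "v \<in> verts G" for v
  proof (cases "degree G v = 3")
    case True
    from M_covers[OF v this] obtain g where "g \<in> ?I v" "g \<in> M" by auto
    then have "?I v - M \<subset> ?I v" by auto
    from psubset_card_mono[OF fin this] show ?thesis
      using True unfolding degree_def by simp
  next
    case False
    then have "card (?I v) \<le> 2" using le3[OF v] unfolding degree_def by simp
    then show ?thesis using card_mono[OF fin, of "?I v - M" v] by auto
  qed
  have h_proper: "e = f" if v: "v \<in> verts G" and e: "e \<in> ?I v - M" and f: "f \<in> ?I v - M"
    and eq: "h e = h f" for v e f
  proof (rule ccontr)
    assume ne: "e \<noteq> f"
    let ?A = "\<lambda>a. {e \<in> ?I v - M. h e = a}"
    have "card {e, f} \<le> card (?A (h e))"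
      using e f eq fin by (intro card_mono) auto
    then have 2: "card (?A (h e)) \<ge> 2" using ne by simp
    moreover have "card (?A (h e)) \<le> card (?A (\<not> h e)) + 1"
      using h[OF v, of "h e" "\<not> h e"] unfolding h_class .
    moreover have "card (?I v - M) = card (?A (h e)) + card (?A (\<not> h e))"
    proof -
      have "?A (h e) \<union> ?A (\<not> h e) = ?I v - M" by auto
      moreover have "card (?A (h e) \<union> ?A (\<not> h e)) = card (?A (h e)) + card (?A (\<not> h e))"
        using fin[of v] by (intro card_Un_disjoint) auto
      ultimately show ?thesis by (simp only:)
    qed
    ultimately show False using rest2[OF v] by simp
  qed
  \<comment> \<open>An edge of \<open>M\<close> needs color 1 if its end of degree 2, if any, has an edge of color 2.\<close>
  define low where "low g \<longleftrightarrow> (\<exists>v\<in>ends G g. degree G v = 2 \<and> (\<exists>f\<in>?I v - M. h f))" for g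
  define c :: "'e \<Rightarrow> nat" where
    "c e = (if e \<in> M then if low e then 1 else 4 else if h e then 2 else 3)" for e
  have inj: "inj_on c (?I v)" if v: "v \<in> verts G" for v
  proof (rule inj_onI)
    fix e f assume "e \<in> ?I v" "f \<in> ?I v" "c e = c f"
    then show "e = f"
      using M_matching[OF v, of e f] h_proper[OF v, of e f]
      unfolding c_def by (auto split: if_splits)
  qed
  have proper: "proper_edge_coloring G c"
    unfolding proper_edge_coloring_def
  proof (intro ballI impI)
    fix e f assume ef: "e \<in> edges G" "f \<in> edges G" "e \<noteq> f \<and> ends G e \<inter> ends G f \<noteq> {}"
    then obtain v where "v \<in> ends G e" "v \<in> ends G f" by auto
    then show "c e \<noteq> c f"
      using inj_onD[OF inj[of v], of e f] ef verts unfolding incident_edges_def by auto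
  qed
  have interval: "\<exists>a b. c ` ?I v = {a..b}" if v: "v \<in> verts G" for v
  proof -
    have card_c: "card (c ` ?I v) = degree G v"
      unfolding degree_def by (rule card_image[OF inj[OF v]])
    consider "degree G v = 0" | "degree G v = 1" | "degree G v = 2" | "degree G v = 3"
      using le3[OF v] by linarith
    then show ?thesis
    proof cases
      case 1
      then have "c ` ?I v = {1..0}"
        using fin unfolding degree_def by simp
      then show ?thesis by blast
    next
      case 2
      then obtain a where "c ` ?I v = {a}"
        using card_c by (auto simp: card_1_singleton_iff)
      then have "c ` ?I v = {a..a}" by simp
      then show ?thesis by blast
    next
      case 3
      then obtain e f where ef: "?I v = {e, f}" "e \<noteq> f"
        unfolding degree_def card_2_iff by blast
      have mixed: "c ` ?I v = {1..2} \<or> c ` ?I v = {3..4}"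
        if gf: "?I v = {g, f}" "g \<in> M" "f \<notin> M" for g f
      proof -
        have vg: "v \<in> ends G g" "g \<in> edges G"
          using gf(1) unfolding incident_edges_def by auto
        then obtain w where w: "ends G g = {v, w}"
          using G unfolding is_multigraph_def by (metis card_2_iff insertE singletonD insert_commute)
        \<comment> \<open>Some end of \<open>g\<close> has degree 3. It is not \<open>v\<close>, so only \<open>v\<close> decides the color of \<open>g\<close>.\<close>
        have "degree G w = 3"
          using \<open>g \<in> M\<close> w 3 unfolding M_def by auto
        then have "low g \<longleftrightarrow> h f"
          unfolding low_def w using 3 gf by auto
        then have "c g = 1 \<and> c f = 2 \<or> c g = 4 \<and> c f = 3"
          unfolding c_def using gf by auto
        moreover have "{1..2} = {1, 2::nat}" "{3..4} = {4, 3::nat}" by auto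
        ultimately show ?thesis unfolding gf(1) by auto
      qed
      have "e \<notin> M \<or> f \<notin> M"
        using M_matching[OF v, of e f] ef by auto
      then consider "e \<in> M" "f \<notin> M" | "f \<in> M" "e \<notin> M" | "e \<notin> M" "f \<notin> M" by blast
      then show ?thesis
      proof cases
        case 1
        then show ?thesis using mixed[of e f] ef by blast
      next
        case 2
        then show ?thesis using mixed[of f e] ef by (metis insert_commute)
      next
        case 3
        then have "h e \<noteq> h f" using h_proper[OF v, of e f] ef by auto
        then have "c ` ?I v = {2, 3}" unfolding ef(1) c_def using 3 by auto
        also have "\<dots> = {2..3}" by auto
        finally show ?thesis by blast
      qed
    next
      case 4
      from M_covers[OF v this] obtain g where g: "g \<in> ?I v" "g \<in> M" by auto
      have only: "e \<in> M \<longleftrightarrow> e = g" if "e \<in> ?I v" for e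
        using M_matching[OF v, of e g] g that by auto
      have "card (?I v - {g}) = 2"
        using 4 g fin unfolding degree_def by simp
      then obtain e f where ef: "?I v - {g} = {e, f}" "e \<noteq> f"
        unfolding card_2_iff by blast
      then have I: "?I v = {g, e, f}" using g by auto
      have "e \<notin> M" "f \<notin> M" using only[of e] only[of f] ef I by auto
      moreover from this have "h e \<noteq> h f" using h_proper[OF v, of e f] ef I by auto
      ultimately have "c ` ?I v = {1, 2, 3} \<or> c ` ?I v = {4, 2, 3}"
        unfolding I c_def using g by auto
      moreover have "{1, 2, 3} = {1..3::nat}" "{4, 2, 3} = {2..4::nat}" by auto
      ultimately show ?thesis by metis
    qed
  qed
  have "interval_coloring G 4 c"
    using proper interval unfolding interval_coloring_def by (auto simp: c_def)
  then show ?thesis unfolding interval_colorable_def by (intro exI[of _ 4]) auto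
qed

theorem proposition3p5:
  fixes G :: "('v, 'e) multigraph"
  assumes "is_multigraph G"
    and "bipartite G"
    and "max_degree G \<ge> 4"
  shows "interval_thickness G \<le> nat \<lceil>real (max_degree G) / 3\<rceil> \<and>
    (\<exists>Hs. length Hs = nat \<lceil>real (max_degree G) / 3\<rceil> \<and>
       decomposition G Hs \<and>
       (\<forall>H\<in>set Hs. interval_colorable H) \<and>
       (\<forall>v\<in>verts G. \<forall>i<length Hs. \<forall>j<length Hs.
          \<bar>int (degree (Hs ! i) v) - int (degree (Hs ! j) v)\<bar> \<le> 1))"
proof -
  note G = assms(1) and bip = assms(2)
  define k where "k = nat \<lceil>real (max_degree G) / 3\<rceil>"
  have "real (max_degree G) / 3 > 0" using assms(3) by simp
  then have k: "k > 0" unfolding k_def by simp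
  have "real (max_degree G) \<le> 3 * real k" unfolding k_def by linarith
  then have deg: "degree G v \<le> 3 * k" if "v \<in> verts G" for v
  proof -
    have "finite (verts G)" using G unfolding is_multigraph_def by simp
    then have "degree G v \<le> max_degree G"
      unfolding max_degree_def using that by (intro Max_ge) auto
    then show ?thesis using \<open>real (max_degree G) \<le> 3 * real k\<close> by linarith
  qed
  obtain c where c: "\<forall>e\<in>edges G. c e < k" and eq: "\<forall>v\<in>verts G. \<forall>i<k. \<forall>j<k.
      degree (color_class G c i) v \<le> degree (color_class G c j) v + 1"
    using equitable_edge_coloring[OF G bip k] by blast
  define Hs where "Hs = map (color_class G c) [0..<k]"
  have len: "length Hs = k" and nth: "\<And>i. i < k \<Longrightarrow> Hs ! i = color_class G c i"
    unfolding Hs_def by auto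
  have sub: "{e \<in> edges G. c e = i} \<subseteq> edges G" for i by auto
  have "subgraph (color_class G c i) G" for i
    using restrict_edges_multigraph[OF G sub] unfolding subgraph_def by auto
  moreover have "\<exists>!i. i < k \<and> e \<in> edges (Hs ! i)" if "e \<in> edges G" for e
    using that c nth by (intro ex1I[of _ "c e"]) auto
  ultimately have decomp: "decomposition G Hs"
    unfolding decomposition_def len by (auto simp: Hs_def)
  have "interval_colorable (color_class G c i)" if "i < k" for i
  proof (rule interval_colorable_if_degree_le_3)
    show "is_multigraph (color_class G c i)" "bipartite (color_class G c i)"
      using restrict_edges_multigraph[OF G sub] restrict_edges_bipartite[OF bip sub] by auto
    show "degree (color_class G c i) v \<le> 3" if "v \<in> verts (color_class G c i)" for v
      using equitable_class_degree_le[OF G c, of v 3 i] eq deg that \<open>i < k\<close> by simp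
  qed
  then have colorable: "\<forall>H\<in>set Hs. interval_colorable H" unfolding Hs_def by auto
  have "\<bar>int (degree (Hs ! i) v) - int (degree (Hs ! j) v)\<bar> \<le> 1"
    if "v \<in> verts G" "i < k" "j < k" for v i j
  proof -
    have "degree (Hs ! i) v \<le> degree (Hs ! j) v + 1" "degree (Hs ! j) v \<le> degree (Hs ! i) v + 1"
      using eq that nth by simp_all
    then show ?thesis by linarith
  qed
  moreover have "interval_thickness G \<le> k"
    unfolding interval_thickness_def using k len decomp colorable by (intro Least_le) blast
  ultimately show ?thesis
    using len decomp colorable unfolding k_def[symmetric] by blast
qed

end
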